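(* There is a strict complete stable marriage instance $S$ of size $5$, with rank-complement matrices $A,B$, for which $$\frac15\sum_{i,j}\min(A_{ij},B_{ij})=7,\qquad \beta(S)=13,$$ but for no complete matching $\mu$ does the blocking graph of $\mu$ contain a complete bipartite subgraph of area greater than $6$.
   Context: An instance $S$ of size $n$ consists of $n$ men and $n$ women, each with a strict complete preference order on the other side. $r_M(i,j)\in\{1,\dots,n\}$ is the rank of woman $j$ in man $i$'s list and $r_W(j,i)\in\{1,\dots,n\}$ the rank of man $i$ in woman $j$'s list (1 is best). The rank-complement matrices are $A_{ij}=n-r_M(i,j)$ and $B_{ij}=n-r_W(j,i)$. A complete matching is a bijection $\mu$ from men to women. $(i,j)$ blocks $\mu$ if man $i$ strictly prefers woman $j$ to his partner under $\mu$ and woman $j$ strictly prefers man $i$ to her partner under $\mu$; $B_S(\mu)$ is the number of blocking pairs and $\beta(S)=\max_\mu B_S(\mu)$. The blocking graph of $\mu$ is the bipartite graph between men and women whose edges are the blocking pairs of $\mu$. The area of a complete bipartite subgraph with parts $X$ (men) and $Y$ (women) is $|X|\,|Y|$. *)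

theory Defs
  imports Complex_Main
begin

text \<open>Men and women are both labelled by \<open>{1..n}\<close>, where \<open>n = inst_size S\<close>; the type \<open>nat\<close> of a
  label does not show its side. A strict complete preference order is given as the list of all
  labels of the other side, best first. Preferences outside \<open>{1..n}\<close> are irrelevant junk.\<close>

record smi =
  inst_size :: nat
  man_list :: "nat \<Rightarrow> nat list"
  woman_list :: "nat \<Rightarrow> nat list"

definition people :: "smi \<Rightarrow> nat set" where
  "people S = {1..inst_size S}"

definition sm_instance :: "smi \<Rightarrow> bool" where
  "sm_instance S \<longleftrightarrow>
     (\<forall>i\<in>people S. distinct (man_list S i) \<and> set (man_list S i) = people S) \<and>
     (\<forall>j\<in>people S. distinct (woman_list S j) \<and> set (woman_list S j) = people S)"

text \<open>One-based position in a list, so that rank 1 is best.\<close>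

definition list_rank :: "nat list \<Rightarrow> nat \<Rightarrow> nat" where
  "list_rank xs x = Suc (length (takeWhile (\<lambda>y. y \<noteq> x) xs))"

definition rank_M :: "smi \<Rightarrow> nat \<Rightarrow> nat \<Rightarrow> nat" where
  "rank_M S i j = list_rank (man_list S i) j"

definition rank_W :: "smi \<Rightarrow> nat \<Rightarrow> nat \<Rightarrow> nat" where
  "rank_W S j i = list_rank (woman_list S j) i"

text \<open>Both matrices are indexed by (man, woman).\<close>

definition compl_A :: "smi \<Rightarrow> nat \<Rightarrow> nat \<Rightarrow> int" where
  "compl_A S i j = int (inst_size S) - int (rank_M S i j)"

definition compl_B :: "smi \<Rightarrow> nat \<Rightarrow> nat \<Rightarrow> int" where
  "compl_B S i j = int (inst_size S) - int (rank_W S j i)"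

definition complete_matching :: "smi \<Rightarrow> (nat \<Rightarrow> nat) \<Rightarrow> bool" where
  "complete_matching S \<mu> \<longleftrightarrow> bij_betw \<mu> (people S) (people S)"

text \<open>The partner of woman \<open>j\<close> is the man \<open>\<mu>\<close> sends to \<open>j\<close>.\<close>

definition man_of :: "smi \<Rightarrow> (nat \<Rightarrow> nat) \<Rightarrow> nat \<Rightarrow> nat" where
  "man_of S \<mu> j = inv_into (people S) \<mu> j"

definition blocks :: "smi \<Rightarrow> (nat \<Rightarrow> nat) \<Rightarrow> nat \<Rightarrow> nat \<Rightarrow> bool" where
  "blocks S \<mu> i j \<longleftrightarrow>
     rank_M S i j < rank_M S i (\<mu> i) \<and> rank_W S j i < rank_W S j (man_of S \<mu> j)"

text \<open>The blocking graph is represented by its set of edges, each written as a pair (man, woman).\<close>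

definition blocking_graph :: "smi \<Rightarrow> (nat \<Rightarrow> nat) \<Rightarrow> (nat \<times> nat) set" where
  "blocking_graph S \<mu> = {(i, j). i \<in> people S \<and> j \<in> people S \<and> blocks S \<mu> i j}"

definition num_blocking :: "smi \<Rightarrow> (nat \<Rightarrow> nat) \<Rightarrow> nat" where
  "num_blocking S \<mu> = card (blocking_graph S \<mu>)"

text \<open>A matching is a function on all of \<open>nat\<close>, so there are infinitely many of them when the values
  outside \<open>{1..n}\<close> are counted. The set of attained numbers is nevertheless finite and
  nonempty, as proved below, so \<open>Max\<close> has its intended meaning.\<close>

definition beta :: "smi \<Rightarrow> nat" where
  "beta S = Max {num_blocking S \<mu> | \<mu>. complete_matching S \<mu>}"

definition complete_bipartite_subgraph ::
    "smi \<Rightarrow> (nat \<times> nat) set \<Rightarrow> nat set \<Rightarrow> nat set \<Rightarrow> bool" where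
  "complete_bipartite_subgraph S E X Y \<longleftrightarrow> X \<subseteq> people S \<and> Y \<subseteq> people S \<and> X \<times> Y \<subseteq> E"

definition area :: "nat set \<Rightarrow> nat set \<Rightarrow> nat" where
  "area X Y = card X * card Y"

lemma finite_num_blocking: "finite {num_blocking S \<mu> | \<mu>. complete_matching S \<mu>}"
proof -
  have "num_blocking S \<mu> \<le> card (people S \<times> people S)" for \<mu>
    unfolding num_blocking_def
    by (rule card_mono) (auto simp: blocking_graph_def people_def)
  then have "{num_blocking S \<mu> | \<mu>. complete_matching S \<mu>} \<subseteq> {..card (people S \<times> people S)}"
    by blast
  then show ?thesis
    by (rule finite_subset) simp
qed

lemma num_blocking_nonempty: "{num_blocking S \<mu> | \<mu>. complete_matching S \<mu>} \<noteq> {}"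
proof -
  have "complete_matching S id"
    by (simp add: complete_matching_def)
  then show ?thesis by blast
qed

end

theory Submission
  imports Defs "HOL-Combinatorics.Multiset_Permutations"
begin

text \<open>The instance was found by simulated annealing over pairs of preference profiles. All of its
  properties are finite statements about the 120 permutations of \<open>{1..5}\<close>, decided by rewriting
  once a matching \<open>\<mu>\<close> is encoded as the list \<open>[\<mu> 1, \<dots>, \<mu> 5]\<close>. Every complete bipartite
  subgraph lies in one whose right side consists of all common neighbours of the left side, so
  only the 32 choices of the left side need to be tested.\<close>

text \<open>By distinctness the scan for \<open>xs ! k\<close> passes exactly the \<open>k\<close>
  entries before it. Hence \<open>list_rank\<close> inverts \<open>nth\<close> up to the shift by
  one.\<close>

lemma list_rank_nth:
  assumes "distinct xs" "k < length xs"
  shows "list_rank xs (xs ! k) = Suc k"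
proof -
  have "takeWhile (\<lambda>y. y \<noteq> xs ! k) xs = take k xs"
    using assms by (intro takeWhile_eq_take_P_nth) (auto simp: nth_eq_iff_index_eq)
  then show ?thesis
    using assms by (simp add: list_rank_def)
qed

definition matching_list :: "smi \<Rightarrow> (nat \<Rightarrow> nat) \<Rightarrow> nat list" where
  "matching_list S \<mu> = map \<mu> [1..<Suc (inst_size S)]"

lemma people_eq_set: "people S = set [1..<Suc (inst_size S)]"
  by (auto simp: people_def)

text \<open>Makes the search finite: functions that differ only outside \<open>people S\<close>
  share one list, and bijectivity becomes distinctness plus the right set of entries.\<close>

lemma complete_matching_iff:
  "complete_matching S \<mu> \<longleftrightarrow> matching_list S \<mu> \<in> permutations_of_set (people S)"
  by (auto simp: complete_matching_def matching_list_def permutations_of_set_def bij_betw_def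
      distinct_map people_eq_set simp del: upt_Suc set_upt)

lemma nth_matching_list:
  assumes "i \<in> people S"
  shows "matching_list S \<mu> ! (i - 1) = \<mu> i"
  using assms nth_map_upt[of "i - 1" "Suc (inst_size S)" 1 \<mu>]
  by (auto simp: matching_list_def people_def simp del: upt_Suc)

text \<open>The one-based position of \<open>j\<close> in the list of values is its preimage under
  \<open>\<mu>\<close>, so \<open>inv_into\<close> is replaced by something computable.\<close>

lemma man_of_eq_list_rank:
  assumes "complete_matching S \<mu>" "j \<in> people S"
  shows "man_of S \<mu> j = list_rank (matching_list S \<mu>) j"
proof -
  obtain i where i: "i \<in> people S" "j = \<mu> i"
    using assms by (auto simp: complete_matching_def bij_betw_def)
  have "man_of S \<mu> j = i"
    using assms i by (simp add: man_of_def complete_matching_def bij_betw_inv_into_left)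
  moreover have "distinct (matching_list S \<mu>)"
    using assms by (simp add: complete_matching_iff permutations_of_set_def)
  \<comment> \<open>Here \<open>Suc (i - 1) = i\<close>, because labels start at 1.\<close>
  then have "list_rank (matching_list S \<mu>) (matching_list S \<mu> ! (i - 1)) = Suc (i - 1)"
    using i by (intro list_rank_nth) (auto simp: matching_list_def people_def)
  ultimately show ?thesis
    using i nth_matching_list[OF i(1)] by (simp add: people_def)
qed

text \<open>Executable form of the blocking graph, with \<open>m\<close> in the role of
  \<open>matching_list S \<mu>\<close>: \<open>m ! (i - 1)\<close> is the partner of man
  \<open>i\<close> and \<open>list_rank m j\<close> that of woman \<open>j\<close>.\<close>

definition blocking_pairs :: "smi \<Rightarrow> nat list \<Rightarrow> (nat \<times> nat) list" where
  "blocking_pairs S m =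
     [(i, j). i \<leftarrow> [1..<Suc (inst_size S)], j \<leftarrow> [1..<Suc (inst_size S)],
       rank_M S i j < rank_M S i (m ! (i - 1)) \<and> rank_W S j i < rank_W S j (list_rank m j)]"

lemma set_blocking_pairs:
  assumes "complete_matching S \<mu>"
  shows "set (blocking_pairs S (matching_list S \<mu>)) = blocking_graph S \<mu>"
proof -
  have "set (blocking_pairs S m) = {(i, j). i \<in> people S \<and> j \<in> people S \<and>
      rank_M S i j < rank_M S i (m ! (i - 1)) \<and> rank_W S j i < rank_W S j (list_rank m j)}" for m
    by (auto simp: blocking_pairs_def people_def simp del: upt_Suc)
  then show ?thesis
    using assms by (auto simp: blocking_graph_def blocks_def man_of_eq_list_rank
        nth_matching_list simp del: One_nat_def)
qed

text \<open>The first disjunct only saves time: it spares the enumeration for matchings with few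
  blocking pairs.\<close>

definition bicliques_bounded :: "nat \<Rightarrow> nat \<Rightarrow> (nat \<times> nat) list \<Rightarrow> bool" where
  "bicliques_bounded n b E \<longleftrightarrow> length E \<le> b \<or>
     (\<forall>xs\<in>set (subseqs [1..<Suc n]).
        length xs * length (filter (\<lambda>j. \<forall>i\<in>set xs. (i, j) \<in> set E) [1..<Suc n]) \<le> b)"

lemma area_le_of_bicliques_bounded:
  assumes "bicliques_bounded (inst_size S) b E" "complete_bipartite_subgraph S (set E) X Y"
  shows "area X Y \<le> b"
proof (cases "length E \<le> b")
  case True
  have "area X Y = card (X \<times> Y)"
    by (simp add: area_def card_cartesian_product)
  also have "\<dots> \<le> card (set E)"
    using assms(2) by (intro card_mono) (auto simp: complete_bipartite_subgraph_def)
  also have "\<dots> \<le> b"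
    using True card_length[of E] by simp
  finally show ?thesis .
next
  case False
  let ?people = "[1..<Suc (inst_size S)]"
  have XY: "X \<subseteq> set ?people" "Y \<subseteq> set ?people" "X \<times> Y \<subseteq> set E"
    using assms(2) by (simp_all add: complete_bipartite_subgraph_def people_eq_set del: upt_Suc)
  obtain xs where xs: "xs \<in> set (subseqs ?people)" "X = set xs"
    using subset_subseqs[OF XY(1)] by blast
  let ?ys = "filter (\<lambda>j. \<forall>i\<in>set xs. (i, j) \<in> set E) ?people"
  \<comment> \<open>\<open>?ys\<close> lists the common neighbours of \<open>X\<close>, and
    \<open>X \<times> Y\<close> consists of edges.\<close>
  have "Y \<subseteq> set ?ys"
    using XY xs by auto
  then have "card Y \<le> card (set ?ys)"
    by (intro card_mono) auto
  also have "\<dots> \<le> length ?ys"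
    by (rule card_length)
  finally have "area X Y \<le> length xs * length ?ys"
    unfolding area_def xs(2) by (intro mult_le_mono card_length)
  also have "\<dots> \<le> b"
    using assms(1) False xs(1) unfolding bicliques_bounded_def by blast
  finally show ?thesis .
qed

text \<open>Entry \<open>i - 1\<close> of each outer list belongs to the person labelled
  \<open>i\<close>, since list positions start at 0.\<close>

definition sparse_instance :: smi where
  "sparse_instance =
     \<lparr>inst_size = 5,
      man_list = (\<lambda>i. [[3,4,1,5,2], [2,1,3,4,5], [2,5,1,3,4], [2,4,5,3,1], [4,1,5,2,3]] ! (i - 1)),
      woman_list = (\<lambda>j. [[2,5,1,4,3], [5,2,3,4,1], [1,5,3,2,4], [5,3,1,2,4], [3,5,4,2,1]] ! (j - 1))\<rparr>"

lemma inst_size_sparse_instance [simp]: "inst_size sparse_instance = 5"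
  by (simp add: sparse_instance_def)

lemma sm_instance_sparse_instance: "sm_instance sparse_instance"
  by code_simp

text \<open>The required mean 7, multiplied by 5 to stay within the integers.\<close>

lemma sum_min_sparse_instance:
  "(\<Sum>i\<in>people sparse_instance. \<Sum>j\<in>people sparse_instance.
      min (compl_A sparse_instance i j) (compl_B sparse_instance i j)) = 35"
  by code_simp

text \<open>For the upper bound on \<open>beta\<close>: the length of a list dominates its number of
  different entries.\<close>

lemma length_blocking_pairs_sparse_instance:
  "\<forall>m\<in>permutations_of_set (people sparse_instance).
     length (blocking_pairs sparse_instance m) \<le> 13"
  by code_simp

lemma bicliques_bounded_sparse_instance:
  "\<forall>m\<in>permutations_of_set (people sparse_instance).
     bicliques_bounded 5 6 (blocking_pairs sparse_instance m)"
  by code_simp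

text \<open>For the lower bound on \<open>beta\<close>: distinctness is checked too, so that the
  length is the exact number of blocking pairs.\<close>

lemma thirteen_blocking_pairs_sparse_instance:
  "\<exists>m\<in>permutations_of_set (people sparse_instance).
     length (blocking_pairs sparse_instance m) = 13 \<and> distinct (blocking_pairs sparse_instance m)"
  by code_simp

lemma num_blocking_sparse_instance_le:
  assumes "complete_matching sparse_instance \<mu>"
  shows "num_blocking sparse_instance \<mu> \<le> 13"
proof -
  have "num_blocking sparse_instance \<mu>
      \<le> length (blocking_pairs sparse_instance (matching_list sparse_instance \<mu>))"
    unfolding num_blocking_def set_blocking_pairs[OF assms, symmetric] by (rule card_length)
  also have "\<dots> \<le> 13"
    using assms length_blocking_pairs_sparse_instance by (simp add: complete_matching_iff)
  finally show ?thesis .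
qed

lemma num_blocking_sparse_instance_eq:
  "\<exists>\<mu>. complete_matching sparse_instance \<mu> \<and> num_blocking sparse_instance \<mu> = 13"
proof -
  obtain m where m: "m \<in> permutations_of_set (people sparse_instance)"
      "length (blocking_pairs sparse_instance m) = 13" "distinct (blocking_pairs sparse_instance m)"
    using thirteen_blocking_pairs_sparse_instance by blast
  have "length m = 5"
    using m(1) length_finite_permutations_of_set[OF m(1)] by (simp add: people_def)
  \<comment> \<open>Decoding \<open>m\<close> into a function and encoding that again returns
    \<open>m\<close>, so the evaluated facts about \<open>m\<close> apply to a genuine
    matching.\<close>
  then have eq: "matching_list sparse_instance (\<lambda>i. m ! (i - 1)) = m"
    by (intro nth_equalityI) (simp_all add: matching_list_def del: upt_Suc)
  have "complete_matching sparse_instance (\<lambda>i. m ! (i - 1))"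
    using m(1) unfolding complete_matching_iff eq .
  moreover from set_blocking_pairs[OF this]
  have "num_blocking sparse_instance (\<lambda>i. m ! (i - 1)) = 13"
    using m(2,3) distinct_card[OF m(3)] unfolding num_blocking_def eq by simp
  ultimately show ?thesis by blast
qed

lemma beta_sparse_instance: "beta sparse_instance = 13"
  unfolding beta_def
proof (rule Max_eqI[OF finite_num_blocking])
  show "y \<le> 13" if "y \<in> {num_blocking sparse_instance \<mu> |\<mu>. complete_matching sparse_instance \<mu>}" for y
    using that num_blocking_sparse_instance_le by blast
  show "13 \<in> {num_blocking sparse_instance \<mu> |\<mu>. complete_matching sparse_instance \<mu>}"
    using num_blocking_sparse_instance_eq by force
qed

lemma area_sparse_instance_le:
  assumes "complete_matching sparse_instance \<mu>"
    and "complete_bipartite_subgraph sparse_instance (blocking_graph sparse_instance \<mu>) X Y"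
  shows "area X Y \<le> 6"
proof (rule area_le_of_bicliques_bounded)
  let ?E = "blocking_pairs sparse_instance (matching_list sparse_instance \<mu>)"
  show "bicliques_bounded (inst_size sparse_instance) 6 ?E"
    using assms(1) bicliques_bounded_sparse_instance by (simp add: complete_matching_iff)
  show "complete_bipartite_subgraph sparse_instance (set ?E) X Y"
    using assms by (simp add: set_blocking_pairs)
qed

theorem proposition7p3:
  shows "\<exists>S. sm_instance S \<and> inst_size S = 5 \<and>
    (1 / 5 :: real) * (\<Sum>i\<in>people S. \<Sum>j\<in>people S.
        real_of_int (min (compl_A S i j) (compl_B S i j))) = 7 \<and>
    beta S = 13 \<and>
    \<not> (\<exists>\<mu> X Y. complete_matching S \<mu> \<and>
          complete_bipartite_subgraph S (blocking_graph S \<mu>) X Y \<and> area X Y > 6)"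
proof (intro exI conjI)
  show "(1 / 5 :: real) * (\<Sum>i\<in>people sparse_instance. \<Sum>j\<in>people sparse_instance.
      real_of_int (min (compl_A sparse_instance i j) (compl_B sparse_instance i j))) = 7"
    \<comment> \<open>The cast to the reals moves outside both sums, which leaves 35 / 5 =
      7.\<close>
    unfolding of_int_sum[symmetric] sum_min_sparse_instance by simp
  show "\<not> (\<exists>\<mu> X Y. complete_matching sparse_instance \<mu> \<and>
      complete_bipartite_subgraph sparse_instance (blocking_graph sparse_instance \<mu>) X Y \<and>
      area X Y > 6)"
    using area_sparse_instance_le by (meson not_le)
qed (simp_all add: sm_instance_sparse_instance beta_sparse_instance)

end
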